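(* Let $A\in\mathbb{C}^{n\times n}$ be diagonalizable, $A=V\Lambda V^{-1}$ with $\Lambda=\operatorname{diag}(\lambda_1,\ldots,\lambda_n)$ and $V=[v_1\cdots v_n]$ invertible, and let $U=[u_1\cdots u_n]$ be defined by $U^*:=V^{-1}$, so that $U^*V=I$. Then for all $x\in\mathbb{C}^n$, $$x=\sum_{k=1}^n v_k u_k^* x,\qquad\text{and}\qquad I=\sum_{k=1}^n v_k u_k^*.$$
   Context: $U^*$ denotes the conjugate transpose of $U$, and $I$ is the $n\times n$ identity matrix. The columns $v_k$ of $V$ are right eigenvectors of $A$ ($Av_k=\lambda_k v_k$), and the columns $u_k$ of $U$ are left eigenvectors ($u_k^*A=\lambda_k u_k^*$) scaled biorthonormally, i.e. $u_k^*v_\ell=\delta_{k\ell}$. *)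

theory Defs
  imports "HOL-Analysis.Analysis"
begin

definition conj_transpose :: "complex^'n^'m \<Rightarrow> complex^'m^'n"
  where "conj_transpose M = (\<chi> i j. cnj (M $ j $ i))"

definition diag_matrix :: "'a::zero^'n \<Rightarrow> 'a^'n^'n"
  where "diag_matrix d = (\<chi> i j. if i = j then d $ i else 0)"

text \<open>The \<open>k\<close>-th column of a matrix as a matrix with a single column, so that
  products of a column and a conjugate-transposed column can be written with \<open>**\<close>.\<close>

definition column_mat :: "'n \<Rightarrow> 'a^'n^'m \<Rightarrow> 'a^1^'m"
  where "column_mat k M = columnvector (column k M)"

end

theory Submission
  imports Defs
begin

text \<open>Both identities come from reading a matrix product by outer products: \<open>V U\<^sup>*\<close> is the
  sum over \<open>k\<close> of the \<open>k\<close>-th column of \<open>V\<close> times the \<open>k\<close>-th row of \<open>U\<^sup>*\<close>, and that row is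
  \<open>u\<^sub>k\<^sup>*\<close>. As \<open>U\<^sup>* = V\<^sup>-\<^sup>1\<close>, the product is \<open>I\<close>, which resolves the identity into the rank-one
  matrices \<open>v\<^sub>k u\<^sub>k\<^sup>*\<close>; applying this resolution to \<open>x\<close> gives the expansion of \<open>x\<close>.\<close>

text \<open>Entry \<open>(i, j)\<close> of the \<open>k\<close>-th summand is the \<open>k\<close>-th term of the usual formula for entry
  \<open>(i, j)\<close> of the product, because the index joining two single-column factors takes only one
  value.\<close>

lemma sum_column_outer_products:
  fixes V :: "complex^'n^'m" and U :: "complex^'n^'p"
  shows "(\<Sum>k\<in>UNIV. column_mat k V ** conj_transpose (column_mat k U)) = V ** conj_transpose U"
  by (simp add: vec_eq_iff matrix_matrix_mult_def column_mat_def columnvector_def column_def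
      conj_transpose_def sum_1)

lemma sum_matrix_vector_mult:
  fixes B :: "'i \<Rightarrow> 'a::comm_semiring_1^'n^'m"
  shows "(\<Sum>k\<in>S. B k *v x) = (\<Sum>k\<in>S. B k) *v x"
  by (induction S rule: infinite_finite_induct) (simp_all add: matrix_vector_mult_add_rdistrib)

theorem theorem3p2:
  fixes A V U :: "complex^'n^'n" and lam :: "complex^'n"
  assumes "invertible V"
    and "A = V ** diag_matrix lam ** matrix_inv V"
    and "conj_transpose U = matrix_inv V"
  shows "(\<forall>x :: complex^'n.
            x = (\<Sum>k\<in>UNIV. (column_mat k V ** conj_transpose (column_mat k U)) *v x))
       \<and> (mat 1 :: complex^'n^'n)
            = (\<Sum>k\<in>UNIV. column_mat k V ** conj_transpose (column_mat k U))"
proof -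
  have "V ** conj_transpose U = mat 1"
    using someI_ex[OF assms(1)[unfolded invertible_def]] by (simp add: assms(3) matrix_inv_def)
  then have "(\<Sum>k\<in>UNIV. column_mat k V ** conj_transpose (column_mat k U)) = mat 1"
    by (simp add: sum_column_outer_products)
  then show ?thesis
    by (simp add: sum_matrix_vector_mult)
qed

end
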